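(* Consider the M-MMSE scheme (uplink detector and downlink precoder) and the quantities $\bar\eta^{\rm ul}_{jk}$, $\bar\eta^{\rm dl}_{jk}$, $\mathbf D$, $\mathbf F$ described in the context, with $L=|\mathcal L|$ cells labelled $1,\dots,L$. Suppose that the uplink powers $\{\tau_{jk}\}$ achieve the uplink SINR approximations $\bar\eta^{\rm ul}_{jk}$, for all users $k$ in all cells $j$. Let $\mathbf\Psi={\rm diag}\{\bar\eta^{\rm ul}_{11},\dots,\bar\eta^{\rm ul}_{LK}\}$ and $\mathbf 1=[1,\dots,1]^T\in\mathbb R^{LK}$. Then the downlink power control policy $\{\varrho_{jk}\}$, $\boldsymbol\varrho=[\varrho_{11},\dots,\varrho_{LK}]^T$, obtained from the uplink powers by $$\boldsymbol\varrho=\frac{\sigma^2}{M}\big(\mathbf D-\mathbf\Psi\mathbf F^T\big)^{-1}\mathbf\Psi\mathbf 1$$ satisfies $$\sum_{j\in\mathcal L}\sum_{k=1}^K\tau_{jk}=\sum_{j\in\mathcal L}\sum_{k=1}^K\varrho_{jk}$$ and the same SINRs (hence the same spectral efficiencies) are achieved in the downlink, i.e. $\bar\eta^{\rm dl}_{jk}=\bar\eta^{\rm ul}_{jk}$ for all $j,k$.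
   Context: Setting. There is a set $\mathcal L=\{1,\dots,L\}$ of cells, each with a base station with $M$ antennas and $K$ users. User $k$ of cell $l$ has position $\mathbf z_{lk}$; $d_j(\mathbf z_{lk})>0$ is its deterministic channel attenuation to base station $j$; $p_{lk}\ge0$ its pilot power; $\tau_{lk}\geq 0$ its uplink payload power; $\varrho_{lk}$ its downlink payload power; $i_{lk}\in\{1,\dots,B\}$ the index of its pilot sequence, where $B=\beta K$, $\beta\ge1$, and the pilot sequences $\mathbf v_1,\dots,\mathbf v_B\in\mathbb C^B$ satisfy $\mathbf v_{b_1}^H\mathbf v_{b_2}=B$ if $b_1=b_2$ and $0$ otherwise. $\sigma^2>0$ is the noise variance. The M-MMSE detector is $\mathbf g_{jk}=(\hat{\mathbf H}_{\mathcal V,j}\mathbf\Lambda_j\hat{\mathbf H}_{\mathcal V,j}^H+(\sigma^2+\varphi_j)\mathbf I_M)^{-1}\hat{\mathbf h}_{jjk}$ and the precoder is $\mathbf g_{jk}/\sqrt{\gamma_{jk}}$, $\gamma_{jk}=\mathbb E\{\|\mathbf g_{jk}\|^2\}$, where $\hat{\mathbf h}_{\mathcal V,ji}$ (the $i$th column of $\hat{\mathbf H}_{\mathcal V,j}$) is a zero-mean complex Gaussian vector of covariance $\tilde{\mathbf\Phi}_{\mathcal V,ji}$ below, and $\hat{\mathbf h}_{jjk}=\sqrt{p_{jk}}d_j(\mathbf z_{jk})\hat{\mathbf h}_{\mathcal V,ji_{jk}}$ is the MMSE channel estimate; the precoder is well defined, i.e. $\gamma_{jk}>0$ (which forces $p_{jk}>0$).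 The statement only involves the deterministic large-scale quantities below. Let $\alpha_{ji}=\big(\sum_{\ell,m}p_{\ell m}d_j(\mathbf z_{\ell m})\mathbf v_i^H\mathbf v_{i_{\ell m}}+\sigma^2\big)^{-1}$, $\tilde{\mathbf\Phi}_{\mathcal V,ji}=\alpha_{ji}B\,\mathbf I_M$, $\lambda_{ji}=\sum_{(l,k):\,i_{lk}=i}\tau_{lk}p_{lk}d_j^2(\mathbf z_{lk})$, $\mathbf\Lambda_j={\rm diag}(\lambda_{j1},\dots,\lambda_{jB})$, $\varphi_j=\sum_{l,k}\tau_{lk}d_j(\mathbf z_{lk})(1-p_{lk}d_j(\mathbf z_{lk})\alpha_{ji_{lk}}B)$. For each cell $j$ let $\rho_j=\frac{\sigma^2+\varphi_j}{M}$ and $\mathbf R_{b}=\lambda_{jb}\tilde{\mathbf\Phi}_{\mathcal V,jb}$, $b=1,\dots,B$. Let $e_b=\lim_{t\to\infty}e_b^{(t)}$, where $e_b^{(0)}=1/\rho_j$ and $e_b^{(t)}=\frac1M{\rm tr}\Big(\mathbf R_b\big(\frac1M\sum_{i=1}^B\frac{\mathbf R_i}{1+e_i^{(t-1)}}+\rho_j\mathbf I_M\big)^{-1}\Big)$. Then $\mathbf T_j=\Big(\frac1M\sum_{b=1}^B\frac{\mathbf R_b}{1+e_b}+\rho_j\mathbf I_M\Big)^{-1}$. For Hermitian nonnegative definite $\mathbf\Theta$ let $\mathbf e'=[e'_1,\dots,e'_B]^T=(\mathbf I_B-\mathbf J)^{-1}\mathbf v$ with $[\mathbf J]_{bl}=\frac{\frac1M{\rm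 tr}(\mathbf R_b\mathbf T_j\mathbf R_l\mathbf T_j)}{M(1+e_l)^2}$, $[\mathbf v]_b=\frac1M{\rm tr}(\mathbf R_b\mathbf T_j\mathbf\Theta\mathbf T_j)$, and $\mathcal T_j(\mathbf\Theta)=\mathbf T_j\mathbf\Theta\mathbf T_j+\mathbf T_j\Big(\frac1M\sum_{b=1}^B\frac{\mathbf R_b e'_b}{(1+e_b)^2}\Big)\mathbf T_j$. Set $\mathbf T'_{jk}=\mathcal T_j(\tilde{\mathbf\Phi}_{\mathcal V,ji_{jk}})$, $\mathbf T''_{jk}=\mathcal T_j(\mathbf I_M)$, and $\delta_{jk}=\frac1M{\rm tr}(\tilde{\mathbf\Phi}_{\mathcal V,ji_{jk}}\mathbf T_j)$, $\vartheta_{jlm}=\frac1M{\rm tr}(\tilde{\mathbf\Phi}_{\mathcal V,ji_{lm}}\mathbf T_j)$, $\vartheta'_{jlmk}=\frac1M{\rm tr}(\tilde{\mathbf\Phi}_{\mathcal V,ji_{lm}}\mathbf T'_{jk})$, $\vartheta''_{jk}=\frac1M{\rm tr}(\tilde{\mathbf\Phi}_{\mathcal V,ji_{jk}}\mathbf T''_{jk})$, $\mu_{jlmk}=\frac1M{\rm tr}(\mathbf T'_{jk})-p_{lm}d_j(\mathbf z_{lm})\lambda_{ji_{lm}}\vartheta'_{jlmk}\vartheta_{jlm}\frac{2+\lambda_{ji_{lm}}\vartheta_{jlm}}{(1+\lambda_{ji_{lm}}\vartheta_{jlm})^2}$. Large-scale SINR approximations: $$\bar\eta^{\rm ul}_{jk}=\frac{\tau_{jk}p_{jk}d_j^2(\mathbf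 z_{jk})\delta_{jk}^2}{\delta_{jk}^2\sum_{(l,m)\neq(j,k),\,i_{lm}=i_{jk}}\tau_{lm}p_{lm}d_j^2(\mathbf z_{lm})+\sum_{i_{lm}\neq i_{jk}}\tau_{lm}d_j(\mathbf z_{lm})\frac{\mu_{jlmk}}{M}+\frac{\sigma^2}{M}\vartheta''_{jk}},$$ $$\bar\eta^{\rm dl}_{jk}=\frac{\varrho_{jk}p_{jk}d_j^2(\mathbf z_{jk})\frac{\delta_{jk}^2}{\vartheta''_{jk}}}{p_{jk}\sum_{(l,m)\ne(j,k),\,i_{lm}=i_{jk}}\varrho_{lm}d_l^2(\mathbf z_{jk})\frac{\delta_{lm}^2}{\vartheta''_{lm}}+\sum_{i_{lm}\ne i_{jk}}\varrho_{lm}d_l(\mathbf z_{jk})\frac{\mu_{ljkm}}{M\vartheta''_{lm}}+\frac{\sigma^2}{M}}.$$ In both, $\delta,\mu,\vartheta''$ are computed from the uplink powers $\{\tau_{jk}\}$. Matrices. $\mathbf D,\mathbf F\in\mathbb R^{LK\times LK}$, with the user $(j,k)$ indexed by $k+(j-1)K$ (the same ordering is used for $\boldsymbol\varrho$ and $\mathbf\Psi$): $\mathbf D$ is diagonal with $D_{k+(j-1)K,\,k+(j-1)K}=\frac{p_{jk}d_j^2(\mathbf z_{jk})\delta_{jk}^2}{\vartheta''_{jk}}$; $F_{k+(j-1)K,\,m+(l-1)K}$ equals $0$ if $(l,m)=(j,k)$, equals $\frac{\delta_{jk}^2p_{lm}d_j^2(\mathbf z_{lm})}{\vartheta''_{jk}}$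 if $i_{lm}=i_{jk}$ and $(l,m)\neq(j,k)$, and equals $\frac{d_j(\mathbf z_{lm})\mu_{jlmk}}{M\vartheta''_{jk}}$ if $i_{lm}\neq i_{jk}$. *)

theory Defs
  imports "HOL-Analysis.Analysis"
begin

text \<open>
  Dimensions are cardinalities of finite index types: \<open>'c\<close> cells, \<open>'k\<close> users per cell,
  \<open>'b\<close> pilot sequences and \<open>'m\<close> antennas, so L, K, B, M are \<open>CARD('c)\<close>, \<open>CARD('k)\<close>,
  \<open>CARD('b)\<close>, \<open>CARD('m)\<close>. User k of cell l is the pair (l, k), and vectors and matrices of
  size LK are indexed by the type \<open>'c \<times> 'k\<close>. User positions live in an arbitrary type \<open>'p\<close>.
  The field \<open>antennas\<close> has only one value; it attaches the type \<open>'m\<close> to the network.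
  The field \<open>noise_var\<close> is $\sigma^2$, not $\sigma$.
\<close>

record ('c, 'k, 'b, 'm, 'p) network =
  antennas :: "'m itself"
  attenuation :: "'c \<Rightarrow> 'p \<Rightarrow> real"
  position :: "'c \<Rightarrow> 'k \<Rightarrow> 'p"
  pilot_power :: "'c \<Rightarrow> 'k \<Rightarrow> real"
  ul_power :: "'c \<Rightarrow> 'k \<Rightarrow> real"
  pilot_index :: "'c \<Rightarrow> 'k \<Rightarrow> 'b"
  pilot_seq :: "'b \<Rightarrow> complex ^ 'b"
  noise_var :: real

definition herm_prod :: "complex ^ 'n \<Rightarrow> complex ^ 'n \<Rightarrow> complex" where
  "herm_prod u w = (\<Sum>n\<in>UNIV. cnj (u $ n) * w $ n)"

text \<open>
  The normalized trace $\frac1M{\rm tr}$. It is only applied to products of Hermitian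
  nonnegative definite matrices whose trace is real, so taking the real part merely changes
  the type.
\<close>

definition ntr :: "complex ^ 'm ^ 'm \<Rightarrow> real" where
  "ntr A = Re (trace A) / real CARD('m)"

definition gain :: "('c, 'k, 'b::finite, 'm, 'p) network \<Rightarrow> 'c \<Rightarrow> 'c \<Rightarrow> 'k \<Rightarrow> real" where
  "gain N j l m = attenuation N j (position N l m)"

text \<open>The real part in \<open>alpha\<close> is again a type change: orthogonal pilots make the sum real.\<close>

definition alpha :: "('c::finite, 'k::finite, 'b::finite, 'm::finite, 'p) network \<Rightarrow> 'c \<Rightarrow> 'b \<Rightarrow> real"
  where
  "alpha N j i = inverse (Re (\<Sum>l\<in>UNIV. \<Sum>m\<in>UNIV.
      complex_of_real (pilot_power N l m * gain N j l m) *
      herm_prod (pilot_seq N i) (pilot_seq N (pilot_index N l m))) + noise_var N)"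

definition Phi :: "('c::finite, 'k::finite, 'b::finite, 'm::finite, 'p) network \<Rightarrow> 'c \<Rightarrow> 'b
    \<Rightarrow> complex ^ 'm ^ 'm" where
  "Phi N j i = (alpha N j i * real CARD('b)) *\<^sub>R mat 1"

definition lam :: "('c::finite, 'k::finite, 'b::finite, 'm::finite, 'p) network \<Rightarrow> 'c \<Rightarrow> 'b \<Rightarrow> real"
  where
  "lam N j i = (\<Sum>(l, k) \<in> {(l, k). pilot_index N l k = i}.
      ul_power N l k * pilot_power N l k * (gain N j l k)\<^sup>2)"

definition phi :: "('c::finite, 'k::finite, 'b::finite, 'm::finite, 'p) network \<Rightarrow> 'c \<Rightarrow> real" where
  "phi N j = (\<Sum>l\<in>UNIV. \<Sum>k\<in>UNIV. ul_power N l k * gain N j l k *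
      (1 - pilot_power N l k * gain N j l k * alpha N j (pilot_index N l k) * real CARD('b)))"

text \<open>The regularization $\rho_j$, not to be confused with the downlink powers $\varrho_{jk}$ (\<open>\<rho>\<close> below).\<close>

definition reg :: "('c::finite, 'k::finite, 'b::finite, 'm::finite, 'p) network \<Rightarrow> 'c \<Rightarrow> real" where
  "reg N j = (noise_var N + phi N j) / real CARD('m)"

definition Rmat :: "('c::finite, 'k::finite, 'b::finite, 'm::finite, 'p) network \<Rightarrow> 'c \<Rightarrow> 'b
    \<Rightarrow> complex ^ 'm ^ 'm" where
  "Rmat N j b = lam N j b *\<^sub>R Phi N j b"

definition resolvent :: "('c::finite, 'k::finite, 'b::finite, 'm::finite, 'p) network \<Rightarrow> 'c
    \<Rightarrow> ('b \<Rightarrow> real) \<Rightarrow> complex ^ 'm ^ 'm" where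
  "resolvent N j e = matrix_inv
     ((1 / real CARD('m)) *\<^sub>R (\<Sum>i\<in>UNIV. (1 / (1 + e i)) *\<^sub>R Rmat N j i) + reg N j *\<^sub>R mat 1)"

primrec e_iter :: "('c::finite, 'k::finite, 'b::finite, 'm::finite, 'p) network \<Rightarrow> 'c \<Rightarrow> nat
    \<Rightarrow> 'b \<Rightarrow> real" where
  "e_iter N j 0 = (\<lambda>b. 1 / reg N j)"
| "e_iter N j (Suc t) = (\<lambda>b. ntr (Rmat N j b ** resolvent N j (e_iter N j t)))"

definition e_lim :: "('c::finite, 'k::finite, 'b::finite, 'm::finite, 'p) network \<Rightarrow> 'c \<Rightarrow> 'b \<Rightarrow> real"
  where
  "e_lim N j b = lim (\<lambda>t. e_iter N j t b)"

definition Tmat :: "('c::finite, 'k::finite, 'b::finite, 'm::finite, 'p) network \<Rightarrow> 'c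
    \<Rightarrow> complex ^ 'm ^ 'm" where
  "Tmat N j = resolvent N j (e_lim N j)"

definition Jmat :: "('c::finite, 'k::finite, 'b::finite, 'm::finite, 'p) network \<Rightarrow> 'c
    \<Rightarrow> real ^ 'b ^ 'b" where
  "Jmat N j = (\<chi> b l. ntr (Rmat N j b ** Tmat N j ** Rmat N j l ** Tmat N j) /
      (real CARD('m) * (1 + e_lim N j l)\<^sup>2))"

definition vvec :: "('c::finite, 'k::finite, 'b::finite, 'm::finite, 'p) network \<Rightarrow> 'c
    \<Rightarrow> complex ^ 'm ^ 'm \<Rightarrow> real ^ 'b" where
  "vvec N j \<Theta> = (\<chi> b. ntr (Rmat N j b ** Tmat N j ** \<Theta> ** Tmat N j))"

definition e_prime :: "('c::finite, 'k::finite, 'b::finite, 'm::finite, 'p) network \<Rightarrow> 'c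
    \<Rightarrow> complex ^ 'm ^ 'm \<Rightarrow> real ^ 'b" where
  "e_prime N j \<Theta> = matrix_inv (mat 1 - Jmat N j) *v vvec N j \<Theta>"

definition Tcal :: "('c::finite, 'k::finite, 'b::finite, 'm::finite, 'p) network \<Rightarrow> 'c
    \<Rightarrow> complex ^ 'm ^ 'm \<Rightarrow> complex ^ 'm ^ 'm" where
  "Tcal N j \<Theta> = Tmat N j ** \<Theta> ** Tmat N j +
     Tmat N j ** ((1 / real CARD('m)) *\<^sub>R
       (\<Sum>b\<in>UNIV. (e_prime N j \<Theta> $ b / (1 + e_lim N j b)\<^sup>2) *\<^sub>R Rmat N j b)) ** Tmat N j"

definition T1 :: "('c::finite, 'k::finite, 'b::finite, 'm::finite, 'p) network \<Rightarrow> 'c \<Rightarrow> 'k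
    \<Rightarrow> complex ^ 'm ^ 'm" where
  "T1 N j k = Tcal N j (Phi N j (pilot_index N j k))"

definition T2 :: "('c::finite, 'k::finite, 'b::finite, 'm::finite, 'p) network \<Rightarrow> 'c \<Rightarrow> 'k
    \<Rightarrow> complex ^ 'm ^ 'm" where
  "T2 N j k = Tcal N j (mat 1)"

definition delta :: "('c::finite, 'k::finite, 'b::finite, 'm::finite, 'p) network \<Rightarrow> 'c \<Rightarrow> 'k \<Rightarrow> real"
  where
  "delta N j k = ntr (Phi N j (pilot_index N j k) ** Tmat N j)"

definition theta :: "('c::finite, 'k::finite, 'b::finite, 'm::finite, 'p) network
    \<Rightarrow> 'c \<Rightarrow> 'c \<Rightarrow> 'k \<Rightarrow> real" where
  "theta N j l m = ntr (Phi N j (pilot_index N l m) ** Tmat N j)"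

definition theta1 :: "('c::finite, 'k::finite, 'b::finite, 'm::finite, 'p) network
    \<Rightarrow> 'c \<Rightarrow> 'c \<Rightarrow> 'k \<Rightarrow> 'k \<Rightarrow> real" where
  "theta1 N j l m k = ntr (Phi N j (pilot_index N l m) ** T1 N j k)"

definition theta2 :: "('c::finite, 'k::finite, 'b::finite, 'm::finite, 'p) network
    \<Rightarrow> 'c \<Rightarrow> 'k \<Rightarrow> real" where
  "theta2 N j k = ntr (Phi N j (pilot_index N j k) ** T2 N j k)"

definition mu :: "('c::finite, 'k::finite, 'b::finite, 'm::finite, 'p) network
    \<Rightarrow> 'c \<Rightarrow> 'c \<Rightarrow> 'k \<Rightarrow> 'k \<Rightarrow> real" where
  "mu N j l m k = ntr (T1 N j k) -
     pilot_power N l m * gain N j l m * lam N j (pilot_index N l m) *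
     theta1 N j l m k * theta N j l m *
     ((2 + lam N j (pilot_index N l m) * theta N j l m) /
      (1 + lam N j (pilot_index N l m) * theta N j l m)\<^sup>2)"

definition eta_ul :: "('c::finite, 'k::finite, 'b::finite, 'm::finite, 'p) network \<Rightarrow> 'c \<Rightarrow> 'k \<Rightarrow> real"
  where
  "eta_ul N j k =
     ul_power N j k * pilot_power N j k * (gain N j j k)\<^sup>2 * (delta N j k)\<^sup>2 /
     ((delta N j k)\<^sup>2 *
        (\<Sum>(l, m) \<in> {(l, m). (l, m) \<noteq> (j, k) \<and> pilot_index N l m = pilot_index N j k}.
           ul_power N l m * pilot_power N l m * (gain N j l m)\<^sup>2)
      + (\<Sum>(l, m) \<in> {(l, m). pilot_index N l m \<noteq> pilot_index N j k}.
           ul_power N l m * gain N j l m * (mu N j l m k / real CARD('m)))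
      + noise_var N / real CARD('m) * theta2 N j k)"

text \<open>
  \<open>\<rho>\<close> is the vector of downlink powers. The quantities \<open>delta\<close>, \<open>mu\<close> and \<open>theta2\<close> still
  depend on the uplink powers stored in \<open>N\<close>.
\<close>

definition eta_dl :: "('c::finite, 'k::finite, 'b::finite, 'm::finite, 'p) network
    \<Rightarrow> real ^ ('c \<times> 'k) \<Rightarrow> 'c \<Rightarrow> 'k \<Rightarrow> real" where
  "eta_dl N \<rho> j k =
     \<rho> $ (j, k) * pilot_power N j k * (gain N j j k)\<^sup>2 * ((delta N j k)\<^sup>2 / theta2 N j k) /
     (pilot_power N j k *
        (\<Sum>(l, m) \<in> {(l, m). (l, m) \<noteq> (j, k) \<and> pilot_index N l m = pilot_index N j k}.
           \<rho> $ (l, m) * (gain N l j k)\<^sup>2 * ((delta N l m)\<^sup>2 / theta2 N l m))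
      + (\<Sum>(l, m) \<in> {(l, m). pilot_index N l m \<noteq> pilot_index N j k}.
           \<rho> $ (l, m) * gain N l j k * (mu N l j k m / (real CARD('m) * theta2 N l m)))
      + noise_var N / real CARD('m))"

definition diag_mat :: "('n \<Rightarrow> real) \<Rightarrow> real ^ 'n ^ 'n" where
  "diag_mat f = (\<chi> u w. if u = w then f u else 0)"

definition Dmat :: "('c::finite, 'k::finite, 'b::finite, 'm::finite, 'p) network
    \<Rightarrow> real ^ ('c \<times> 'k) ^ ('c \<times> 'k)" where
  "Dmat N = diag_mat (\<lambda>(j, k).
     pilot_power N j k * (gain N j j k)\<^sup>2 * (delta N j k)\<^sup>2 / theta2 N j k)"

definition Fmat :: "('c::finite, 'k::finite, 'b::finite, 'm::finite, 'p) network
    \<Rightarrow> real ^ ('c \<times> 'k) ^ ('c \<times> 'k)" where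
  "Fmat N = (\<chi> u w. case (u, w) of ((j, k), (l, m)) \<Rightarrow>
     if (l, m) = (j, k) then 0
     else if pilot_index N l m = pilot_index N j k
       then (delta N j k)\<^sup>2 * pilot_power N l m * (gain N j l m)\<^sup>2 / theta2 N j k
     else gain N j l m * mu N j l m k / (real CARD('m) * theta2 N j k))"

definition Psi :: "('c::finite, 'k::finite, 'b::finite, 'm::finite, 'p) network
    \<Rightarrow> real ^ ('c \<times> 'k) ^ ('c \<times> 'k)" where
  "Psi N = diag_mat (\<lambda>(j, k). eta_ul N j k)"

end

theory Submission
  imports Defs
begin

text \<open>
  Since every covariance matrix is a multiple of the identity, the deterministic equivalents
  reduce to scalars. The fixed-point iteration becomes a monotone scalar iteration, its limit
  \<open>t\<close> satisfies $t\,(\rho_j + \frac1M\sum_b r_b/(1+r_b t)) = 1$, and this identity forces the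
  rank-one matrix \<open>J\<close> to have its only nonzero eigenvalue below 1. Together with
  $p_{lm}d_j(\mathbf z_{lm})\alpha_{ji_{lm}}B \le 1$, which holds because the pilot power of user \<open>(l, m)\<close>
  is part of the denominator of \<open>\<alpha>\<close>, this makes all \<open>\<mu>\<close> and hence all entries of \<open>F\<close>
  nonnegative, and the diagonal of \<open>D\<close> positive.

  The uplink SINR definition reads $D\tau = \Psi G$ with $G = F\tau + \frac{\sigma^2}{M}1 > 0$.
  Eliminating \<open>\<Psi>\<close> turns the downlink equation into
  $G_u\varrho_u = \tau_u((F^T\varrho)_u + \frac{\sigma^2}{M})$. Summing over the users, the terms
  with \<open>F\<close> cancel, because $\sum_u \varrho_u (F\tau)_u = \sum_u \tau_u (F^T\varrho)_u$. Applied to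
  \<open>\<bar>x\<bar>\<close> for a kernel vector, to the negative part of $\varrho$ and to $\varrho$ itself, this
  yields invertibility, nonnegativity and the equality of total powers.
\<close>

section \<open>Uplink-downlink duality for nonnegative coupling matrices\<close>

lemma matrix_inv_cancel:
  fixes A :: "'a::field ^ 'n ^ 'n"
  assumes "invertible A"
  shows "matrix_inv A ** A = mat 1" "A ** matrix_inv A = mat 1"
proof -
  have "\<exists>A'. A ** A' = mat 1 \<and> A' ** A = mat 1"
    using assms by (simp add: invertible_def)
  then have "A ** matrix_inv A = mat 1 \<and> matrix_inv A ** A = mat 1"
    unfolding matrix_inv_def by (rule someI_ex)
  then show "matrix_inv A ** A = mat 1" "A ** matrix_inv A = mat 1" by auto
qed

lemma matrix_inv_vector_eq:
  fixes A :: "'a::field ^ 'n ^ 'n"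
  assumes "invertible A" and "A *v x = y"
  shows "matrix_inv A *v y = x"
  by (metis assms matrix_inv_cancel(1) matrix_vector_mul_assoc matrix_vector_mul_lid)

text \<open>A trivial kernel gives a left inverse, which for a square matrix is two-sided.\<close>

lemma invertible_if_trivial_kernel:
  fixes A :: "'a::field ^ 'n ^ 'n"
  assumes "\<And>x. A *v x = 0 \<Longrightarrow> x = 0"
  shows "invertible A"
  using assms by (metis invertible_left_inverse matrix_left_invertible_ker)

lemma diag_mat_mult_vec: "(diag_mat f *v x) $ u = f u * x $ u"
  by (simp add: diag_mat_def matrix_vector_mult_def if_distrib if_distribR
      cong: if_cong)

lemma transpose_mult_vec: "(transpose A *v x) $ u = (\<Sum>w\<in>UNIV. A $ w $ u * x $ w)"
  by (simp add: transpose_def matrix_vector_mult_def)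

text \<open>The duality argument only uses signs, so it is stated for an arbitrary coupling matrix.
  \<open>d\<close> stands for the diagonal of D and \<open>s\<close> for the noise term
  sigma^2/M.\<close>

locale coupled_powers =
  fixes F :: "real ^ 'n ^ 'n" and d :: "'n \<Rightarrow> real" and \<tau> :: "'n \<Rightarrow> real" and s :: real
  assumes F_nonneg: "\<And>u w. F $ u $ w \<ge> 0"
    and d_pos: "\<And>u. d u > 0"
    and \<tau>_nonneg: "\<And>u. \<tau> u \<ge> 0"
    and s_pos: "s > 0"
begin

text \<open>Uplink interference plus noise, normalized so that the noise term is the same for every
  user.\<close>

definition G :: "'n \<Rightarrow> real" where
  "G u = (\<Sum>w\<in>UNIV. F $ u $ w * \<tau> w) + s"

definition sinr :: "'n \<Rightarrow> real" where
  "sinr u = \<tau> u * d u / G u"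

definition downlink_matrix :: "real ^ 'n ^ 'n" where
  "downlink_matrix = diag_mat d - diag_mat sinr ** transpose F"

lemma G_pos: "G u > 0"
  unfolding G_def by (intro add_nonneg_pos sum_nonneg mult_nonneg_nonneg F_nonneg \<tau>_nonneg s_pos)

text \<open>Exchanging the two sums moves the coupling from \<open>F\<close> acting on \<tau> to its
  transpose acting on \<open>x\<close>.\<close>

lemma sum_G_mult:
  "(\<Sum>u\<in>UNIV. G u * x u)
    = (\<Sum>u\<in>UNIV. \<tau> u * (\<Sum>w\<in>UNIV. F $ w $ u * x w)) + s * (\<Sum>u\<in>UNIV. x u)"
proof -
  have "(\<Sum>u\<in>UNIV. (\<Sum>w\<in>UNIV. F $ u $ w * \<tau> w) * x u)
      = (\<Sum>u\<in>UNIV. \<Sum>w\<in>UNIV. F $ u $ w * \<tau> w * x u)"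
    by (simp add: sum_distrib_right)
  also have "\<dots> = (\<Sum>w\<in>UNIV. \<Sum>u\<in>UNIV. F $ u $ w * \<tau> w * x u)"
    by (rule sum.swap)
  also have "\<dots> = (\<Sum>w\<in>UNIV. \<tau> w * (\<Sum>u\<in>UNIV. F $ u $ w * x u))"
    by (simp add: sum_distrib_left mult_ac)
  finally show ?thesis
    by (simp add: G_def distrib_right sum.distrib sum_distrib_left)
qed

text \<open>Summed over \<open>u\<close>, the inequality loses both coupling terms by
  \<open>sum_G_mult\<close>, leaving \<open>s\<close> times the sum of \<open>x\<close> at most 0.
  This takes the place of a spectral radius bound.\<close>

lemma subsolution_zero:
  assumes nonneg: "\<And>u. x u \<ge> 0"
    and le: "\<And>u. G u * x u \<le> \<tau> u * (\<Sum>w\<in>UNIV. F $ w $ u * x w)"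
  shows "x u = 0"
proof -
  have "s * (\<Sum>u\<in>UNIV. x u) \<le> 0"
    using sum_mono[of UNIV "\<lambda>u. G u * x u", OF le] sum_G_mult[of x] by simp
  then have "(\<Sum>u\<in>UNIV. x u) \<le> 0"
    using s_pos by (simp add: mult_le_0_iff)
  then have "(\<Sum>u\<in>UNIV. x u) = 0"
    using nonneg by (intro antisym sum_nonneg) auto
  then show ?thesis
    using nonneg by (simp add: sum_nonneg_eq_0_iff)
qed

text \<open>Inserting the definition of \<open>sinr\<close> lets the positive factor
  \<open>d u / G u\<close> be pulled out of row \<open>u\<close>.\<close>

lemma downlink_matrix_mult_vec:
  "(downlink_matrix *v x) $ u = d u / G u * (G u * x $ u - \<tau> u * (\<Sum>w\<in>UNIV. F $ w $ u * x $ w))"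
  using G_pos[of u]
  by (simp add: downlink_matrix_def matrix_vector_mult_diff_rdistrib diag_mat_mult_vec
      transpose_mult_vec sinr_def field_simps del: transpose_matrix_vector
      flip: matrix_vector_mul_assoc)

lemma invertible_downlink_matrix: "invertible downlink_matrix"
proof (rule invertible_if_trivial_kernel)
  fix x :: "real ^ 'n"
  assume "downlink_matrix *v x = 0"
  then have eq: "G u * x $ u = \<tau> u * (\<Sum>w\<in>UNIV. F $ w $ u * x $ w)" for u
    using downlink_matrix_mult_vec[of x u] G_pos[of u] d_pos[of u] by simp
  \<comment> \<open>The triangle inequality makes the absolute values of a kernel vector a
    nonnegative subsolution.\<close>
  have "G u * \<bar>x $ u\<bar> \<le> \<tau> u * (\<Sum>w\<in>UNIV. F $ w $ u * \<bar>x $ w\<bar>)" for u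
  proof -
    have "G u * \<bar>x $ u\<bar> = \<bar>\<tau> u * (\<Sum>w\<in>UNIV. F $ w $ u * x $ w)\<bar>"
      using G_pos[of u] by (simp add: abs_mult flip: eq)
    also have "\<dots> = \<tau> u * \<bar>\<Sum>w\<in>UNIV. F $ w $ u * x $ w\<bar>"
      by (simp add: abs_mult \<tau>_nonneg)
    also have "\<dots> \<le> \<tau> u * (\<Sum>w\<in>UNIV. \<bar>F $ w $ u * x $ w\<bar>)"
      by (intro mult_left_mono sum_abs \<tau>_nonneg)
    finally show ?thesis by (simp add: abs_mult F_nonneg)
  qed
  then have "\<bar>x $ u\<bar> = 0" for u
    by (intro subsolution_zero) auto
  then show "x = 0" by (simp add: vec_eq_iff)
qed

context
  fixes \<rho> :: "real ^ 'n"
  assumes \<rho>: "\<rho> = s *\<^sub>R (matrix_inv downlink_matrix *v (diag_mat sinr *v (\<chi> _. 1)))"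
begin

text \<open>The downlink equation with the factor \<open>d u / G u\<close> cancelled: the roles of
  uplink and downlink become symmetric, with \<open>F\<close> transposed.\<close>

lemma downlink_power_eq: "G u * \<rho> $ u = \<tau> u * ((\<Sum>w\<in>UNIV. F $ w $ u * \<rho> $ w) + s)"
proof -
  have "downlink_matrix *v \<rho>
      = s *\<^sub>R (downlink_matrix *v (matrix_inv downlink_matrix *v (diag_mat sinr *v (\<chi> _. 1))))"
    unfolding \<rho> by (rule matrix_vector_mult_scaleR)
  also have "downlink_matrix *v (matrix_inv downlink_matrix *v y) = y" for y
    by (metis invertible_downlink_matrix matrix_inv_cancel(2) matrix_vector_mul_assoc
        matrix_vector_mul_lid)
  finally have "(downlink_matrix *v \<rho>) $ u = s * sinr u"
    by (simp add: diag_mat_mult_vec)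
  then have "d u / G u * (G u * \<rho> $ u - \<tau> u * (\<Sum>w\<in>UNIV. F $ w $ u * \<rho> $ w))
      = d u / G u * (\<tau> u * s)"
    by (simp add: downlink_matrix_mult_vec sinr_def mult_ac)
  moreover have "d u / G u \<noteq> 0"
    using d_pos[of u] G_pos[of u] by simp
  ultimately have "G u * \<rho> $ u - \<tau> u * (\<Sum>w\<in>UNIV. F $ w $ u * \<rho> $ w) = \<tau> u * s"
    by (simp only: mult_cancel_left simp_thms)
  then show ?thesis by (simp add: distrib_left)
qed

lemma downlink_power_nonneg: "\<rho> $ u \<ge> 0"
proof -
  define n where "n w = max (- \<rho> $ w) 0" for w
  have n: "n w \<ge> 0" "- \<rho> $ w \<le> n w" for w by (simp_all add: n_def)
  have "G u * n u \<le> \<tau> u * (\<Sum>w\<in>UNIV. F $ w $ u * n w)" for u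
  proof (cases "n u = 0")
    case True
    then show ?thesis
      by (simp add: \<tau>_nonneg F_nonneg n sum_nonneg)
  next
    case False
    then have "G u * n u = - (G u * \<rho> $ u)" by (simp add: n_def max_def split: if_splits)
    also have "\<dots> = \<tau> u * (\<Sum>w\<in>UNIV. F $ w $ u * - \<rho> $ w) - \<tau> u * s"
      unfolding downlink_power_eq by (simp add: distrib_left sum_negf)
    also have "\<dots> \<le> \<tau> u * (\<Sum>w\<in>UNIV. F $ w $ u * - \<rho> $ w)"
      using \<tau>_nonneg[of u] s_pos by simp
    also have "\<dots> \<le> \<tau> u * (\<Sum>w\<in>UNIV. F $ w $ u * n w)"
      by (intro mult_left_mono sum_mono n F_nonneg \<tau>_nonneg)
    finally show ?thesis .
  qed
  then have "n u = 0" by (intro subsolution_zero) (simp_all add: n)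
  then show ?thesis using n(2)[of u] by simp
qed

text \<open>Both \<open>sum_G_mult\<close> and the summed \<open>downlink_power_eq\<close> evaluate
  the sum of \<open>G u * \<rho> $ u\<close>; their coupling terms agree, and the noise terms give
  the two total powers times \<open>s\<close>.\<close>

lemma total_power_eq: "(\<Sum>u\<in>UNIV. \<rho> $ u) = (\<Sum>u\<in>UNIV. \<tau> u)"
proof -
  have "(\<Sum>u\<in>UNIV. G u * \<rho> $ u) = (\<Sum>u\<in>UNIV. \<tau> u * ((\<Sum>w\<in>UNIV. F $ w $ u * \<rho> $ w) + s))"
    by (simp add: downlink_power_eq)
  also have "\<dots> = (\<Sum>u\<in>UNIV. \<tau> u * (\<Sum>w\<in>UNIV. F $ w $ u * \<rho> $ w)) + s * (\<Sum>u\<in>UNIV. \<tau> u)"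
    by (simp add: distrib_left sum.distrib sum_distrib_left mult.commute)
  finally show ?thesis
    using sum_G_mult[of "\<lambda>u. \<rho> $ u"] s_pos by simp
qed

lemma downlink_sinr_eq: "\<rho> $ u * d u / ((\<Sum>w\<in>UNIV. F $ w $ u * \<rho> $ w) + s) = sinr u"
proof -
  \<comment> \<open>Nonnegativity of \<rho> keeps the downlink denominator positive, which justifies
    cross-multiplying.\<close>
  have "(\<Sum>w\<in>UNIV. F $ w $ u * \<rho> $ w) + s > 0"
    by (intro add_nonneg_pos sum_nonneg mult_nonneg_nonneg F_nonneg downlink_power_nonneg s_pos)
  then show ?thesis
    using G_pos[of u] downlink_power_eq[of u]
    by (simp add: sinr_def frac_eq_eq mult_ac)
qed

end

end

section \<open>Scalar deterministic equivalents\<close>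

text \<open>The first two terms decide the direction, and monotonicity of \<open>g\<close>
  propagates it through the sequence.\<close>

lemma convergent_monotone_iteration:
  fixes g :: "real \<Rightarrow> real"
  assumes mono: "\<And>x y. 0 \<le> x \<Longrightarrow> x \<le> y \<Longrightarrow> g x \<le> g y"
    and step: "\<And>n. s (Suc n) = g (s n)"
    and bounds: "\<And>n. 0 \<le> s n" "\<And>n. s n \<le> C"
  shows "convergent s"
proof -
  have "monoseq s"
  proof (cases "s 0 \<le> s 1")
    case True
    have "s n \<le> s (Suc n)" for n
      by (induction n) (use True in \<open>simp_all add: step mono bounds\<close>)
    then show ?thesis by (simp add: monoseq_Suc)
  next
    case False
    have "s (Suc n) \<le> s n" for n
    proof (induction n)
      case (Suc n)
      then show ?case by (metis step mono bounds(1))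
    qed (use False in simp)
    then show ?thesis by (simp add: monoseq_Suc)
  qed
  moreover have "Bseq s"
    using bounds by (intro BseqI'[of _ C]) simp
  ultimately show ?thesis by (intro Bseq_monoseq_convergent)
qed

lemma matrix_inv_scaleR_mat_1:
  assumes "c \<noteq> 0"
  shows "matrix_inv (c *\<^sub>R mat 1 :: complex ^ 'm ^ 'm) = inverse c *\<^sub>R mat 1"
proof -
  let ?A = "c *\<^sub>R mat 1 :: complex ^ 'm ^ 'm" and ?B = "inverse c *\<^sub>R mat 1 :: complex ^ 'm ^ 'm"
  have "?B ** ?A = mat 1" "?A ** ?B = mat 1"
    using assms by (simp_all add: matrix_scalar_ac flip: scalar_matrix_assoc)
  then show ?thesis
    by (metis invertible_def matrix_inv_cancel(1) matrix_mul_assoc matrix_mul_lid matrix_mul_rid)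
qed

lemma scaleR_mat_1_mult:
  "(a *\<^sub>R mat 1 :: complex ^ 'm ^ 'm) ** (b *\<^sub>R mat 1) = (a * b) *\<^sub>R mat 1"
  by (simp add: matrix_scalar_ac flip: scalar_matrix_assoc)

lemma ntr_scaleR_mat_1: "ntr (c *\<^sub>R mat 1 :: complex ^ 'm ^ 'm) = c"
  by (simp add: ntr_def trace_def mat_def)

lemma sum_users: "(\<Sum>l\<in>UNIV. \<Sum>k\<in>UNIV. f l k) = (\<Sum>(l, k)\<in>UNIV. f l k)"
  by (simp add: sum.cartesian_product)

locale pilot_network =
  fixes N :: "('c::finite, 'k::finite, 'b::finite, 'm::finite, 'p) network"
  assumes orthogonal: "\<And>b b'. herm_prod (pilot_seq N b) (pilot_seq N b') =
      (if b = b' then of_nat CARD('b) else 0)"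
    and attenuation_pos: "\<And>j l k. attenuation N j (position N l k) > 0"
    and pilot_power_pos: "\<And>l k. pilot_power N l k > 0"
    and ul_power_nonneg: "\<And>l k. ul_power N l k \<ge> 0"
    and noise_var_pos: "noise_var N > 0"
begin

section \<open>Estimate variances, pilot loads and regularization\<close>

lemma gain_pos: "gain N j l k > 0"
  by (simp add: gain_def attenuation_pos)

text \<open>The scalar by which \<open>Phi\<close> multiplies the identity.\<close>

definition pilot_var :: "'c \<Rightarrow> 'b \<Rightarrow> real" where
  "pilot_var j i = alpha N j i * real CARD('b)"

definition rscal :: "'c \<Rightarrow> 'b \<Rightarrow> real" where
  "rscal j b = lam N j b * pilot_var j b"

definition resolvent_scalar :: "'c \<Rightarrow> ('b \<Rightarrow> real) \<Rightarrow> real" where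
  "resolvent_scalar j e = inverse ((\<Sum>i\<in>UNIV. rscal j i / (1 + e i)) / real CARD('m) + reg N j)"

text \<open>Orthogonality removes the users of all other pilots; each remaining one contributes the
  real factor B.\<close>

lemma alpha_eq:
  "alpha N j i = inverse (real CARD('b) * (\<Sum>(l, m) \<in> {(l, m). pilot_index N l m = i}.
      pilot_power N l m * gain N j l m) + noise_var N)"
proof -
  have "(\<Sum>l\<in>UNIV. \<Sum>m\<in>UNIV. complex_of_real (pilot_power N l m * gain N j l m) *
      herm_prod (pilot_seq N i) (pilot_seq N (pilot_index N l m)))
    = (\<Sum>(l, m)\<in>UNIV. if pilot_index N l m = i
        then complex_of_real (pilot_power N l m * gain N j l m * real CARD('b)) else 0)"
    unfolding sum_users by (intro sum.cong) (auto simp: orthogonal)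
  also have "\<dots> = (\<Sum>(l, m)\<in>{(l, m). pilot_index N l m = i}.
        complex_of_real (pilot_power N l m * gain N j l m * real CARD('b)))"
    by (rule sum.mono_neutral_cong_right) (auto split: if_splits)
  also have "\<dots> = complex_of_real (real CARD('b) * (\<Sum>(l, m) \<in> {(l, m). pilot_index N l m = i}.
      pilot_power N l m * gain N j l m))"
    by (simp add: sum_distrib_left mult_ac split_def)
  finally show ?thesis
    unfolding alpha_def by (simp only: Re_complex_of_real)
qed

lemma pilot_load_nonneg:
  "real CARD('b) * (\<Sum>(l, m) \<in> {(l, m). pilot_index N l m = i}.
      pilot_power N l m * gain N j l m) \<ge> 0"
  by (intro mult_nonneg_nonneg sum_nonneg)
     (auto intro!: mult_nonneg_nonneg less_imp_le[OF pilot_power_pos] less_imp_le[OF gain_pos])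

lemma alpha_pos: "alpha N j i > 0"
  unfolding alpha_eq
  using pilot_load_nonneg[where j = j and i = i] noise_var_pos by simp

lemma pilot_var_pos: "pilot_var j i > 0"
  by (simp add: pilot_var_def alpha_pos)

text \<open>The left side is one summand of the pilot load divided by the whole load plus noise. The
  bound makes the terms of \<open>phi\<close> nonnegative and returns in
  \<open>mu_nonneg\<close>.\<close>

lemma pilot_var_le: "pilot_power N l k * gain N j l k * pilot_var j (pilot_index N l k) \<le> 1"
proof -
  let ?i = "pilot_index N l k"
  let ?S = "\<Sum>(l, m) \<in> {(l, m). pilot_index N l m = ?i}. pilot_power N l m * gain N j l m"
  have "(\<lambda>(l, m). pilot_power N l m * gain N j l m) (l, k) \<le> ?S"
    by (rule member_le_sum)
       (auto intro!: mult_nonneg_nonneg less_imp_le[OF pilot_power_pos] less_imp_le[OF gain_pos])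
  then have "real CARD('b) * (pilot_power N l k * gain N j l k) \<le> real CARD('b) * ?S"
    by (intro mult_left_mono) auto
  then have "real CARD('b) * (pilot_power N l k * gain N j l k)
      \<le> real CARD('b) * ?S + noise_var N"
    using noise_var_pos by linarith
  moreover have "real CARD('b) * ?S + noise_var N > 0"
    using pilot_load_nonneg[where j = j and i = ?i] noise_var_pos by simp
  ultimately show ?thesis
    by (simp add: pilot_var_def alpha_eq pos_divide_le_eq mult_ac flip: divide_inverse)
qed

lemma reg_pos: "reg N j > 0"
proof -
  have "phi N j \<ge> 0"
    unfolding phi_def using pilot_var_le[of _ _ j]
    by (intro sum_nonneg mult_nonneg_nonneg ul_power_nonneg less_imp_le[OF gain_pos])
       (simp add: pilot_var_def mult.assoc)
  then show ?thesis using noise_var_pos by (simp add: reg_def)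
qed

lemma lam_nonneg: "lam N j i \<ge> 0"
  unfolding lam_def
  by (intro sum_nonneg)
     (auto intro!: mult_nonneg_nonneg ul_power_nonneg less_imp_le[OF pilot_power_pos])

lemma rscal_nonneg: "rscal j b \<ge> 0"
  by (simp add: rscal_def lam_nonneg less_imp_le[OF pilot_var_pos])

lemma Phi_eq: "Phi N j i = pilot_var j i *\<^sub>R mat 1"
  by (simp add: Phi_def pilot_var_def)

lemma Rmat_eq: "Rmat N j b = rscal j b *\<^sub>R mat 1"
  by (simp add: Rmat_def Phi_eq rscal_def)

section \<open>The scalar form of the resolvent\<close>

lemma load_nonneg:
  assumes "\<And>b. e b \<ge> 0"
  shows "(\<Sum>i\<in>UNIV. rscal j i / (1 + e i)) / real CARD('m) \<ge> 0"
  using assms by (intro divide_nonneg_nonneg sum_nonneg rscal_nonneg) auto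

lemma resolvent_scalar_bounds:
  assumes "\<And>b. e b \<ge> 0"
  shows "resolvent_scalar j e > 0" "resolvent_scalar j e \<le> 1 / reg N j"
proof -
  let ?S = "(\<Sum>i\<in>UNIV. rscal j i / (1 + e i)) / real CARD('m)"
  have S: "?S \<ge> 0" by (rule load_nonneg[OF assms])
  then have "?S + reg N j > 0" using reg_pos[of j] by simp
  then show "resolvent_scalar j e > 0" by (simp add: resolvent_scalar_def)
  show "resolvent_scalar j e \<le> 1 / reg N j"
    unfolding resolvent_scalar_def inverse_eq_divide[symmetric]
    using S reg_pos[of j] by (intro le_imp_inverse_le) auto
qed

lemma resolvent_scalar_mono:
  assumes "\<And>b. e b \<ge> 0" and "\<And>b. e b \<le> e' b"
  shows "resolvent_scalar j e \<le> resolvent_scalar j e'"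
proof -
  have e': "e' b \<ge> 0" for b using assms order_trans by blast
  then have "(\<Sum>i\<in>UNIV. rscal j i / (1 + e' i)) / real CARD('m) + reg N j > 0"
    by (intro add_nonneg_pos load_nonneg reg_pos)
  moreover have "(\<Sum>i\<in>UNIV. rscal j i / (1 + e' i)) / real CARD('m)
      \<le> (\<Sum>i\<in>UNIV. rscal j i / (1 + e i)) / real CARD('m)"
    using assms e'
    by (intro divide_right_mono sum_mono divide_left_mono rscal_nonneg mult_pos_pos)
       (auto intro: add_pos_nonneg)
  ultimately show ?thesis
    unfolding resolvent_scalar_def by (intro le_imp_inverse_le) auto
qed

lemma resolvent_eq:
  assumes "\<And>b. e b \<ge> 0"
  shows "resolvent N j e = resolvent_scalar j e *\<^sub>R mat 1"
proof -
  let ?c = "(\<Sum>i\<in>UNIV. rscal j i / (1 + e i)) / real CARD('m) + reg N j"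
  have "(1 / real CARD('m)) *\<^sub>R (\<Sum>i\<in>UNIV. (1 / (1 + e i)) *\<^sub>R Rmat N j i) + reg N j *\<^sub>R mat 1
      = ?c *\<^sub>R (mat 1 :: complex ^ 'm ^ 'm)"
    by (simp add: Rmat_eq scaleR_add_left flip: scaleR_sum_left)
  moreover have "?c > 0"
    by (intro add_nonneg_pos load_nonneg reg_pos assms)
  ultimately show ?thesis
    by (simp add: resolvent_def matrix_inv_scaleR_mat_1 resolvent_scalar_def)
qed

section \<open>The limit of the fixed-point iteration\<close>

lemma e_iter_nonneg: "e_iter N j n b \<ge> 0"
proof (induction n arbitrary: b)
  case 0
  then show ?case using reg_pos[of j] by simp
next
  case (Suc n)
  then show ?case
    by (simp add: resolvent_eq Rmat_eq scaleR_mat_1_mult ntr_scaleR_mat_1 rscal_nonneg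
        less_imp_le[OF resolvent_scalar_bounds(1)])
qed

text \<open>After the first step every iterate is a multiple of the fixed vector
  \<open>rscal j\<close>, so a single scalar sequence determines the iteration.\<close>

lemma e_iter_Suc: "e_iter N j (Suc n) b = rscal j b * resolvent_scalar j (e_iter N j n)"
  by (simp add: resolvent_eq e_iter_nonneg Rmat_eq scaleR_mat_1_mult ntr_scaleR_mat_1)

definition tlim :: "'c \<Rightarrow> real" where
  "tlim j = lim (\<lambda>n. resolvent_scalar j (e_iter N j n))"

lemma resolvent_scalar_iter:
  "resolvent_scalar j (e_iter N j (Suc n))
    = resolvent_scalar j (\<lambda>b. rscal j b * resolvent_scalar j (e_iter N j n))"
  by (simp only: e_iter_Suc[abs_def])

lemma tlim: "(\<lambda>n. resolvent_scalar j (e_iter N j n)) \<longlonglongrightarrow> tlim j"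
proof -
  have "convergent (\<lambda>n. resolvent_scalar j (e_iter N j n))"
  proof (rule convergent_monotone_iteration)
    show "resolvent_scalar j (e_iter N j (Suc n))
        = (\<lambda>x. resolvent_scalar j (\<lambda>b. rscal j b * x)) (resolvent_scalar j (e_iter N j n))" for n
      by (simp only: resolvent_scalar_iter)
    show "resolvent_scalar j (\<lambda>b. rscal j b * x) \<le> resolvent_scalar j (\<lambda>b. rscal j b * y)"
      if "0 \<le> x" "x \<le> y" for x y
      using that by (intro resolvent_scalar_mono) (auto intro: mult_left_mono mult_nonneg_nonneg rscal_nonneg)
    show "0 \<le> resolvent_scalar j (e_iter N j n)"
      "resolvent_scalar j (e_iter N j n) \<le> 1 / reg N j" for n
      by (auto intro: resolvent_scalar_bounds less_imp_le e_iter_nonneg)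
  qed
  then show ?thesis by (simp add: tlim_def convergent_LIMSEQ_iff)
qed

lemma tlim_nonneg: "tlim j \<ge> 0"
  by (rule LIMSEQ_le_const[OF tlim])
     (auto intro!: less_imp_le resolvent_scalar_bounds e_iter_nonneg)

lemma e_lim_eq: "e_lim N j b = rscal j b * tlim j"
proof -
  \<comment> \<open>The start value need not be proportional to \<open>rscal j\<close>; shifting the
    index discards it.\<close>
  have "(\<lambda>n. e_iter N j (Suc n) b) \<longlonglongrightarrow> rscal j b * tlim j"
    unfolding e_iter_Suc by (intro tendsto_intros tlim)
  then show ?thesis
    unfolding e_lim_def by (intro limI) (rule LIMSEQ_imp_Suc)
qed

lemma e_lim_nonneg: "e_lim N j b \<ge> 0"
  by (simp add: e_lim_eq rscal_nonneg tlim_nonneg)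

text \<open>Both sides of \<open>resolvent_scalar_iter\<close> are passed to the limit; continuity
  holds because all denominators are positive at \<open>tlim j\<close>.\<close>

lemma tlim_fixpoint: "resolvent_scalar j (e_lim N j) = tlim j"
proof -
  have "1 + rscal j b * tlim j \<noteq> 0" for b
    using e_lim_nonneg[of j b] by (simp add: e_lim_eq)
  moreover have "(\<Sum>b\<in>UNIV. rscal j b / (1 + rscal j b * tlim j)) / real CARD('m) + reg N j > 0"
    by (intro add_nonneg_pos load_nonneg reg_pos mult_nonneg_nonneg rscal_nonneg tlim_nonneg)
  then have "(\<Sum>b\<in>UNIV. rscal j b / (1 + rscal j b * tlim j)) / real CARD('m) + reg N j \<noteq> 0"
    by simp
  ultimately have "(\<lambda>n. resolvent_scalar j (e_iter N j (Suc n)))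
      \<longlonglongrightarrow> resolvent_scalar j (\<lambda>b. rscal j b * tlim j)"
    unfolding resolvent_scalar_iter
    unfolding resolvent_scalar_def[of j "\<lambda>b. rscal j b * _"]
    by (intro tendsto_intros tlim) auto
  moreover have "(\<lambda>n. resolvent_scalar j (e_iter N j (Suc n))) \<longlonglongrightarrow> tlim j"
    by (rule LIMSEQ_Suc[OF tlim])
  ultimately show ?thesis
    using LIMSEQ_unique by (fastforce simp: e_lim_eq[abs_def])
qed

text \<open>A limit of positive terms is only nonnegative; strictness comes from the fixed point
  being itself a value of the resolvent.\<close>

lemma tlim_pos: "tlim j > 0"
  using resolvent_scalar_bounds(1)[of "e_lim N j" j] by (simp add: tlim_fixpoint e_lim_nonneg)

lemma Tmat_eq: "Tmat N j = tlim j *\<^sub>R mat 1"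
  by (simp add: Tmat_def resolvent_eq e_lim_nonneg tlim_fixpoint)

section \<open>The rank-one matrix J and the operator \<open>Tcal\<close>\<close>

definition Jeig :: "'c \<Rightarrow> real" where
  "Jeig j = (\<Sum>l\<in>UNIV. (rscal j l * tlim j)\<^sup>2 / (1 + e_lim N j l)\<^sup>2) / real CARD('m)"

lemma Jeig_less_1: "Jeig j < 1"
proof -
  let ?S = "(\<Sum>i\<in>UNIV. rscal j i / (1 + e_lim N j i)) / real CARD('m)"
  \<comment> \<open>Used with \<open>x = e_lim N j l\<close>, this bounds \<open>Jeig j\<close> by
    \<open>tlim j * ?S\<close>; the fixed point equation gives
    \<open>tlim j * (?S + reg N j) = 1\<close>.\<close>
  have "x\<^sup>2 / (1 + x)\<^sup>2 \<le> x / (1 + x)" if "x \<ge> 0" for x :: real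
  proof -
    have "x / (1 + x) \<le> 1" "x / (1 + x) \<ge> 0" using that by (simp_all add: field_simps)
    then have "(x / (1 + x)) * (x / (1 + x)) \<le> x / (1 + x)" by (rule mult_left_le)
    then show ?thesis by (simp add: power2_eq_square)
  qed
  then have "(rscal j l * tlim j)\<^sup>2 / (1 + e_lim N j l)\<^sup>2 \<le> tlim j * (rscal j l / (1 + e_lim N j l))"
    for l
    using e_lim_nonneg[of j l] by (simp add: e_lim_eq mult.commute)
  then have "Jeig j \<le> (\<Sum>l\<in>UNIV. tlim j * (rscal j l / (1 + e_lim N j l))) / real CARD('m)"
    unfolding Jeig_def by (intro divide_right_mono sum_mono) auto
  also have "\<dots> = tlim j * ?S"
    by (simp add: sum_distrib_left)
  also have "\<dots> < tlim j * (?S + reg N j)"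
    by (intro mult_strict_left_mono tlim_pos) (simp add: reg_pos)
  also have "\<dots> = 1"
    using tlim_fixpoint[of j] tlim_pos[of j] unfolding resolvent_scalar_def
    by (metis inverse_nonzero_iff_nonzero left_inverse less_numeral_extra(3))
  finally show ?thesis .
qed

text \<open>All matrices are multiples of the identity, so each entry of J factors into a row part
  \<open>rscal j b\<close> and a column part.\<close>

lemma Jmat_mult_vec:
  "Jmat N j *v x = ((\<Sum>l\<in>UNIV. rscal j l * (tlim j)\<^sup>2 / (real CARD('m) * (1 + e_lim N j l)\<^sup>2) * x $ l))
    *\<^sub>R (\<chi> b. rscal j b)"
  by (simp add: vec_eq_iff Jmat_def Rmat_eq Tmat_eq scaleR_mat_1_mult ntr_scaleR_mat_1
      matrix_vector_mult_def sum_distrib_left power2_eq_square mult_ac)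

lemma Jmat_eigenvector: "Jmat N j *v (\<chi> b. rscal j b) = Jeig j *\<^sub>R (\<chi> b. rscal j b)"
  by (simp add: Jmat_mult_vec Jeig_def sum_divide_distrib power_mult_distrib power2_eq_square mult_ac)

text \<open>A kernel vector equals its image under J, hence is a multiple of \<open>rscal j\<close>,
  on which J acts as \<open>Jeig j < 1\<close>.\<close>

lemma invertible_Jmat: "invertible (mat 1 - Jmat N j)"
proof (rule invertible_if_trivial_kernel)
  fix x :: "real ^ 'b"
  assume "(mat 1 - Jmat N j) *v x = 0"
  then have x: "x = Jmat N j *v x" by (simp add: matrix_vector_mult_diff_rdistrib)
  obtain a where "Jmat N j *v x = a *\<^sub>R (\<chi> b. rscal j b)"
    using Jmat_mult_vec by blast
  with x have a: "x = a *\<^sub>R (\<chi> b. rscal j b)" by (rule trans)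
  have "Jmat N j *v x = Jeig j *\<^sub>R x"
    unfolding a matrix_vector_mult_scaleR Jmat_eigenvector by (rule scaleR_left_commute)
  with x have "x = Jeig j *\<^sub>R x" by (rule trans)
  then have "(1 - Jeig j) *\<^sub>R x = 0" unfolding scaleR_diff_left by simp
  then show "x = 0" using Jeig_less_1[of j] by simp
qed

text \<open>For a multiple of the identity, \<open>vvec\<close> is also proportional to
  \<open>rscal j\<close>, so solving the system amounts to dividing by
  \<open>1 - Jeig j\<close>.\<close>

lemma e_prime_eq:
  "e_prime N j (c *\<^sub>R mat 1) = (c * (tlim j)\<^sup>2 / (1 - Jeig j)) *\<^sub>R (\<chi> b. rscal j b)"
  unfolding e_prime_def
proof (rule matrix_inv_vector_eq[OF invertible_Jmat])
  have "(mat 1 - Jmat N j) *v (a *\<^sub>R (\<chi> b. rscal j b)) = (a * (1 - Jeig j)) *\<^sub>R (\<chi> b. rscal j b)"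
    for a
    by (simp add: matrix_vector_mult_diff_rdistrib matrix_vector_mult_scaleR Jmat_eigenvector
        scaleR_diff_left scaleR_diff_right right_diff_distrib)
  moreover have "vvec N j (c *\<^sub>R mat 1) = (c * (tlim j)\<^sup>2) *\<^sub>R (\<chi> b. rscal j b)"
    by (simp add: vvec_def vec_eq_iff Rmat_eq Tmat_eq scaleR_mat_1_mult ntr_scaleR_mat_1
        power2_eq_square mult_ac)
  ultimately show "(mat 1 - Jmat N j) *v ((c * (tlim j)\<^sup>2 / (1 - Jeig j)) *\<^sub>R (\<chi> b. rscal j b))
      = vvec N j (c *\<^sub>R mat 1)"
    using Jeig_less_1[of j] by simp
qed

definition Tscal :: "'c \<Rightarrow> real" where
  "Tscal j = (tlim j)\<^sup>2 / (1 - Jeig j)"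

lemma Tscal_pos: "Tscal j > 0"
  using tlim_pos[of j] Jeig_less_1[of j] by (simp add: Tscal_def)

lemma Tcal_eq: "Tcal N j (c *\<^sub>R mat 1) = (Tscal j * c) *\<^sub>R mat 1"
proof -
  have "(\<Sum>b\<in>UNIV. (e_prime N j (c *\<^sub>R mat 1) $ b / (1 + e_lim N j b)\<^sup>2) *\<^sub>R Rmat N j b)
      = (\<Sum>b\<in>UNIV. Tscal j * c * (rscal j b)\<^sup>2 / (1 + e_lim N j b)\<^sup>2) *\<^sub>R (mat 1 :: complex ^ 'm ^ 'm)"
    unfolding scaleR_sum_left
    by (intro sum.cong refl)
      (simp add: e_prime_eq Rmat_eq Tscal_def power2_eq_square mult_ac)
  then have "Tcal N j (c *\<^sub>R mat 1) = (tlim j * c * tlim j + tlim j * (1 / real CARD('m) *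
      (\<Sum>b\<in>UNIV. Tscal j * c * (rscal j b)\<^sup>2 / (1 + e_lim N j b)\<^sup>2)) * tlim j) *\<^sub>R mat 1"
    by (simp add: Tcal_def Tmat_eq scaleR_mat_1_mult scaleR_add_left)
  also have "tlim j * (1 / real CARD('m) *
      (\<Sum>b\<in>UNIV. Tscal j * c * (rscal j b)\<^sup>2 / (1 + e_lim N j b)\<^sup>2)) * tlim j = Tscal j * c * Jeig j"
    by (simp add: Jeig_def sum_distrib_left sum_divide_distrib power_mult_distrib power2_eq_square
        mult_ac)
  \<comment> \<open>This is \<open>(tlim j)\<^sup>2 = Tscal j * (1 - Jeig j)\<close> times
    \<open>c\<close>.\<close>
  also have "tlim j * c * tlim j + Tscal j * c * Jeig j = Tscal j * c"
    using Jeig_less_1[of j] by (simp add: Tscal_def field_simps power2_eq_square)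
  finally show ?thesis .
qed

lemma T1_eq: "T1 N j k = (Tscal j * pilot_var j (pilot_index N j k)) *\<^sub>R mat 1"
  by (simp add: T1_def Phi_eq Tcal_eq)

lemma T2_eq: "T2 N j k = Tscal j *\<^sub>R mat 1"
  using Tcal_eq[of j 1] by (simp add: T2_def)

section \<open>Signs of the quantities in the SINRs\<close>

lemma delta_pos: "delta N j k > 0"
  by (simp add: delta_def Phi_eq Tmat_eq scaleR_mat_1_mult ntr_scaleR_mat_1 pilot_var_pos tlim_pos)

lemma theta2_pos: "theta2 N j k > 0"
  by (simp add: theta2_def Phi_eq T2_eq scaleR_mat_1_mult ntr_scaleR_mat_1 pilot_var_pos Tscal_pos)

text \<open>In scalars, \<open>mu\<close> is
  \<open>c * (1 - a * (x * (2 + x) / (1 + x)\<^sup>2))\<close>. The fraction is below 1 because its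
  numerator is \<open>(1 + x)\<^sup>2 - 1\<close>, and \<open>a\<close> is at most 1 by
  \<open>pilot_var_le\<close>.\<close>

lemma mu_nonneg: "mu N j l m k \<ge> 0"
proof -
  let ?i = "pilot_index N l m"
  define c where "c = Tscal j * pilot_var j (pilot_index N j k)"
  define x where "x = lam N j ?i * (pilot_var j ?i * tlim j)"
  define a where "a = pilot_power N l m * gain N j l m * pilot_var j ?i"
  have c: "c \<ge> 0"
    by (simp add: c_def less_imp_le[OF Tscal_pos] less_imp_le[OF pilot_var_pos])
  have x: "x \<ge> 0"
    by (simp add: x_def lam_nonneg less_imp_le[OF pilot_var_pos] tlim_nonneg)
  have a: "0 \<le> a" "a \<le> 1"
    by (auto simp: a_def pilot_var_le less_imp_le[OF pilot_var_pos] less_imp_le[OF gain_pos]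
        less_imp_le[OF pilot_power_pos])
  have "x * (2 + x) \<le> (1 + x)\<^sup>2" by (simp add: power2_eq_square algebra_simps)
  then have "x * ((2 + x) / (1 + x)\<^sup>2) \<ge> 0" "x * ((2 + x) / (1 + x)\<^sup>2) \<le> 1"
    using x by (simp_all add: divide_le_eq)
  then have "a * (x * ((2 + x) / (1 + x)\<^sup>2)) \<le> 1"
    by (rule mult_le_one[OF a(2)])
  moreover have "mu N j l m k = c * (1 - a * (x * ((2 + x) / (1 + x)\<^sup>2)))"
    by (simp add: mu_def theta_def theta1_def T1_eq Phi_eq Tmat_eq scaleR_mat_1_mult
        ntr_scaleR_mat_1 flip: x_def)
       (simp add: c_def a_def x_def algebra_simps)
  ultimately show ?thesis using c by simp
qed

lemma Fmat_nonneg: "Fmat N $ u $ w \<ge> 0"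
proof (cases u; cases w)
  fix j k l m
  assume "u = (j, k)" "w = (l, m)"
  moreover have "0 \<le> (delta N j k)\<^sup>2 * pilot_power N l m * (gain N j l m)\<^sup>2 / theta2 N j k"
    by (intro divide_nonneg_pos mult_nonneg_nonneg theta2_pos less_imp_le[OF pilot_power_pos]
        zero_le_power2)
  moreover have "0 \<le> gain N j l m * mu N j l m k / (real CARD('m) * theta2 N j k)"
    by (intro divide_nonneg_pos mult_nonneg_nonneg mult_pos_pos theta2_pos mu_nonneg
        less_imp_le[OF gain_pos]) simp
  ultimately show ?thesis by (simp add: Fmat_def)
qed

section \<open>Identification of the network with the abstract power model\<close>

definition Ddiag :: "'c \<times> 'k \<Rightarrow> real" where
  "Ddiag = (\<lambda>(j, k). pilot_power N j k * (gain N j j k)\<^sup>2 * (delta N j k)\<^sup>2 / theta2 N j k)"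

lemma Ddiag_pos: "Ddiag u > 0"
proof (cases u)
  case (Pair j k)
  show ?thesis
    unfolding Pair Ddiag_def prod.case
    by (intro divide_pos_pos mult_pos_pos zero_less_power gain_pos delta_pos theta2_pos
        pilot_power_pos)
qed

text \<open>Matches the case distinction in \<open>Fmat\<close>, whose zero diagonal meets the
  assumption, with the two interference sums of the SINRs.\<close>

lemma sum_split_pilots:
  fixes f :: "'c \<times> 'k \<Rightarrow> real"
  assumes "f (j, k) = 0"
  shows "(\<Sum>w\<in>UNIV. f w)
    = (\<Sum>w\<in>{(l, m). (l, m) \<noteq> (j, k) \<and> pilot_index N l m = pilot_index N j k}. f w)
    + (\<Sum>w\<in>{(l, m). pilot_index N l m \<noteq> pilot_index N j k}. f w)"
proof -
  let ?A = "{(l, m). (l, m) \<noteq> (j, k) \<and> pilot_index N l m = pilot_index N j k}"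
  let ?B = "{(l, m). pilot_index N l m \<noteq> pilot_index N j k}"
  have "(\<Sum>w\<in>UNIV. f w) = (\<Sum>w\<in>?A \<union> ?B. f w)"
    by (rule sum.mono_neutral_right) (use assms in auto)
  also have "\<dots> = (\<Sum>w\<in>?A. f w) + (\<Sum>w\<in>?B. f w)"
    by (rule sum.union_disjoint) auto
  finally show ?thesis .
qed

sublocale coupled_powers "Fmat N" Ddiag "\<lambda>(l, k). ul_power N l k" "noise_var N / real CARD('m)"
  by unfold_locales (auto simp: Fmat_nonneg Ddiag_pos ul_power_nonneg noise_var_pos)

text \<open>Numerator and denominator of \<open>eta_ul\<close> are those of \<open>sinr\<close>
  multiplied by \<open>theta2 N j k\<close>.\<close>

lemma sinr_eq_eta_ul: "sinr (j, k) = eta_ul N j k"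
proof -
  let ?A = "{(l, m). (l, m) \<noteq> (j, k) \<and> pilot_index N l m = pilot_index N j k}"
  let ?B = "{(l, m). pilot_index N l m \<noteq> pilot_index N j k}"
  let ?\<theta> = "theta2 N j k"
  have \<theta>: "?\<theta> \<noteq> 0" using theta2_pos[of j k] by simp
  have "(\<Sum>w\<in>UNIV. Fmat N $ (j, k) $ w * (case w of (l, m) \<Rightarrow> ul_power N l m))
    = (\<Sum>w\<in>?A. Fmat N $ (j, k) $ w * (case w of (l, m) \<Rightarrow> ul_power N l m))
      + (\<Sum>w\<in>?B. Fmat N $ (j, k) $ w * (case w of (l, m) \<Rightarrow> ul_power N l m))"
    by (rule sum_split_pilots) (simp add: Fmat_def)
  moreover have "?\<theta> * (\<Sum>w\<in>?A. Fmat N $ (j, k) $ w * (case w of (l, m) \<Rightarrow> ul_power N l m))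
    = (delta N j k)\<^sup>2 * (\<Sum>(l, m)\<in>?A. ul_power N l m * pilot_power N l m * (gain N j l m)\<^sup>2)"
    unfolding sum_distrib_left
    by (intro sum.cong refl) (use \<theta> in \<open>auto simp: Fmat_def\<close>)
  moreover have "?\<theta> * (\<Sum>w\<in>?B. Fmat N $ (j, k) $ w * (case w of (l, m) \<Rightarrow> ul_power N l m))
    = (\<Sum>(l, m)\<in>?B. ul_power N l m * gain N j l m * (mu N j l m k / real CARD('m)))"
    unfolding sum_distrib_left
    by (intro sum.cong refl) (use \<theta> in \<open>auto simp: Fmat_def\<close>)
  ultimately have "?\<theta> * G (j, k)
    = (delta N j k)\<^sup>2 * (\<Sum>(l, m)\<in>?A. ul_power N l m * pilot_power N l m * (gain N j l m)\<^sup>2)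
      + (\<Sum>(l, m)\<in>?B. ul_power N l m * gain N j l m * (mu N j l m k / real CARD('m)))
      + noise_var N / real CARD('m) * ?\<theta>"
    by (simp add: G_def distrib_left mult.commute)
  then have "eta_ul N j k
      = ul_power N j k * pilot_power N j k * (gain N j j k)\<^sup>2 * (delta N j k)\<^sup>2 / (?\<theta> * G (j, k))"
    by (simp add: eta_ul_def)
  moreover have "sinr (j, k) = ul_power N j k * Ddiag (j, k) / G (j, k)"
    by (simp add: sinr_def)
  ultimately show ?thesis by (simp add: Ddiag_def mult_ac)
qed

text \<open>Column \<open>(j, k)\<close> of F collects what each user's precoded signal leaks to
  user \<open>(j, k)\<close>, with the normalization by \<open>theta2\<close> already
  inside.\<close>

lemma downlink_load_eq:
  "(\<Sum>w\<in>UNIV. Fmat N $ w $ (j, k) * \<rho> $ w) =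
     pilot_power N j k *
        (\<Sum>(l, m) \<in> {(l, m). (l, m) \<noteq> (j, k) \<and> pilot_index N l m = pilot_index N j k}.
           \<rho> $ (l, m) * (gain N l j k)\<^sup>2 * ((delta N l m)\<^sup>2 / theta2 N l m))
      + (\<Sum>(l, m) \<in> {(l, m). pilot_index N l m \<noteq> pilot_index N j k}.
           \<rho> $ (l, m) * gain N l j k * (mu N l j k m / (real CARD('m) * theta2 N l m)))"
  (is "_ = _ * ?a + ?b")
proof -
  let ?A = "{(l, m). (l, m) \<noteq> (j, k) \<and> pilot_index N l m = pilot_index N j k}"
  let ?B = "{(l, m). pilot_index N l m \<noteq> pilot_index N j k}"
  have "(\<Sum>w\<in>UNIV. Fmat N $ w $ (j, k) * \<rho> $ w)
    = (\<Sum>w\<in>?A. Fmat N $ w $ (j, k) * \<rho> $ w) + (\<Sum>w\<in>?B. Fmat N $ w $ (j, k) * \<rho> $ w)"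
    by (rule sum_split_pilots) (simp add: Fmat_def)
  moreover have "(\<Sum>w\<in>?A. Fmat N $ w $ (j, k) * \<rho> $ w) = pilot_power N j k * ?a"
    unfolding sum_distrib_left by (intro sum.cong refl) (auto simp: Fmat_def)
  moreover have "(\<Sum>w\<in>?B. Fmat N $ w $ (j, k) * \<rho> $ w) = ?b"
    by (intro sum.cong refl) (auto simp: Fmat_def)
  ultimately show ?thesis by simp
qed

lemma eta_dl_eq:
  "eta_dl N \<rho> j k
    = \<rho> $ (j, k) * Ddiag (j, k)
      / ((\<Sum>w\<in>UNIV. Fmat N $ w $ (j, k) * \<rho> $ w) + noise_var N / real CARD('m))"
  by (simp add: eta_dl_def downlink_load_eq Ddiag_def)

lemma Psi_eq: "Psi N = diag_mat sinr"
  unfolding Psi_def by (intro arg_cong[of _ _ diag_mat]) (auto simp: sinr_eq_eta_ul)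

lemma Dmat_eq: "Dmat N = diag_mat Ddiag"
  by (simp add: Dmat_def Ddiag_def)

end

text \<open>Invertibility belongs to the conclusion because \<open>matrix_inv\<close> of a singular
  matrix is an unspecified value; it certifies that the formula for \<rho> has its intended
  meaning.\<close>

theorem theorem5:
  fixes N :: "('c::finite, 'k::finite, 'b::finite, 'm::finite, 'p) network"
    and \<beta> :: real
    and \<rho> :: "real ^ ('c \<times> 'k)"
  assumes "\<beta> \<ge> 1" and "real CARD('b) = \<beta> * real CARD('k)"
    and "\<And>b\<^sub>1 b\<^sub>2. herm_prod (pilot_seq N b\<^sub>1) (pilot_seq N b\<^sub>2) =
           (if b\<^sub>1 = b\<^sub>2 then of_nat CARD('b) else 0)"
    and "\<And>j l k. attenuation N j (position N l k) > 0"
    and "\<And>l k. pilot_power N l k > 0"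
    and "\<And>l k. ul_power N l k \<ge> 0"
    and "noise_var N > 0"
    and "\<rho> = (noise_var N / real CARD('m)) *\<^sub>R
           (matrix_inv (Dmat N - Psi N ** transpose (Fmat N)) *v (Psi N *v (\<chi> _. 1)))"
  shows "invertible (Dmat N - Psi N ** transpose (Fmat N))
    \<and> (\<Sum>j\<in>UNIV. \<Sum>k\<in>UNIV. ul_power N j k) = (\<Sum>j\<in>UNIV. \<Sum>k\<in>UNIV. \<rho> $ (j, k))
    \<and> (\<forall>j k. eta_dl N \<rho> j k = eta_ul N j k)"
proof -
  interpret pilot_network N
    by unfold_locales (use assms in auto)
  have matrix: "Dmat N - Psi N ** transpose (Fmat N) = downlink_matrix"
    by (simp add: downlink_matrix_def Dmat_eq Psi_eq)
  have \<rho>: "\<rho> = (noise_var N / real CARD('m)) *\<^sub>R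
      (matrix_inv downlink_matrix *v (diag_mat sinr *v (\<chi> _. 1)))"
    using assms(8) unfolding matrix unfolding Psi_eq .
  have "(\<Sum>j\<in>UNIV. \<Sum>k\<in>UNIV. ul_power N j k) = (\<Sum>j\<in>UNIV. \<Sum>k\<in>UNIV. \<rho> $ (j, k))"
    using total_power_eq[OF \<rho>] by (simp add: sum_users)
  moreover have "eta_dl N \<rho> j k = eta_ul N j k" for j k
    using downlink_sinr_eq[OF \<rho>] by (simp add: eta_dl_eq sinr_eq_eta_ul)
  ultimately show ?thesis
    using invertible_downlink_matrix by (simp add: matrix)
qed

end
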